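(* Let $A, B \in \mathbb{C}^{n\times n}$ be Hermitian positive semi-definite. Then $$\operatorname{intdim}(A+B) \le \operatorname{intdim}(A) + \operatorname{intdim}(B).$$
   Context: For a non-zero Hermitian positive semi-definite matrix $A\in\mathbb{C}^{n\times n}$, the intrinsic dimension is $\operatorname{intdim}(A) = \operatorname{trace}(A)/\|A\|_2$, where $\|A\|_2$ is the operator two-norm (largest singular value). For the zero matrix, $\operatorname{intdim}(0)=0$. *)

theory Defs
  imports "HOL-Analysis.Analysis"
begin

definition adjoint_matrix :: "complex^'n^'m \<Rightarrow> complex^'m^'n" where
  "adjoint_matrix A = map_matrix cnj (transpose A)"

definition hermitian :: "complex^'n^'n \<Rightarrow> bool" where
  "hermitian A \<longleftrightarrow> adjoint_matrix A = A"

text \<open>The inner product of the library on complex vectors is only the real one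
  (the real part of \<open>x\<^sup>* y\<close>), so the form \<open>x\<^sup>* A x\<close> is written out
  as a sum. Membership in \<open>\<real>\<^sub>\<ge>\<^sub>0\<close> says that it is real and non-negative.\<close>

definition hermitian_psd :: "complex^'n^'n \<Rightarrow> bool" where
  "hermitian_psd A \<longleftrightarrow>
     hermitian A \<and> (\<forall>x. (\<Sum>i\<in>UNIV. cnj (x $ i) * (A *v x) $ i) \<in> \<real>\<^sub>\<ge>\<^sub>0)"

text \<open>The norm on \<open>complex^'n\<close> is the Euclidean norm, so \<open>onorm\<close> gives the
  operator two-norm, i.e. the largest singular value.\<close>

definition norm2 :: "complex^'n^'m \<Rightarrow> real" where
  "norm2 A = onorm (\<lambda>x. A *v x)"

text \<open>The trace of a Hermitian matrix is real; \<open>Re\<close> only changes its type.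
  The definition is meaningful for Hermitian positive semi-definite arguments only.\<close>

definition intdim :: "complex^'n^'n \<Rightarrow> real" where
  "intdim A = (if A = 0 then 0 else Re (trace A) / norm2 A)"

end

theory Submission
  imports Defs
begin

text \<open>Adding a positive semi-definite matrix can only increase the quadratic form, hence also the
  operator norm, because polarization bounds the norm of a positive self-adjoint map by its
  quadratic form. So the denominators \<open>\<parallel>A\<parallel>\<close> and \<open>\<parallel>B\<parallel>\<close> are at most \<open>\<parallel>A + B\<parallel>\<close>, while the
  (non-negative) traces add up.\<close>

lemma norm_le_of_quadratic_form_le:
  fixes f :: "'a::real_inner \<Rightarrow> 'a"
  assumes lin: "linear f"
    and sym: "\<And>x y. x \<bullet> f y = f x \<bullet> y"
    and nonneg: "\<And>x. 0 \<le> x \<bullet> f x"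
    and bound: "\<And>x. x \<bullet> f x \<le> M * (norm x)\<^sup>2"
  shows "norm (f x) \<le> M * norm x"
proof (cases "x = 0")
  case True
  then show ?thesis using linear_0[OF lin] by simp
next
  case False
  then have x: "norm x > 0" by simp
  have M: "0 \<le> M"
  proof -
    have "0 \<le> M * (norm x)\<^sup>2" using nonneg bound order_trans by blast
    then show ?thesis using x by (simp add: zero_le_mult_iff)
  qed
  show ?thesis
  proof (cases "f x = 0")
    case True
    then show ?thesis using M by simp
  next
    case fx: False
    \<comment> \<open>The direction of \<open>f x\<close> turns \<open>y \<bullet> f x\<close> into
      \<open>norm (f x) * norm x\<close>; the length of \<open>x\<close> makes the triangle bound on
      \<open>x + y\<close> exactly \<open>2 * norm x\<close>, whose square cancels the 4 from
      polarization.\<close>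
    define y where "y = (norm x / norm (f x)) *\<^sub>R f x"
    have ny: "norm y = norm x" using fx by (simp add: y_def)
    \<comment> \<open>Polarization: the diagonal terms cancel and symmetry merges the cross terms.
      The form at \<open>x - y\<close> is then dropped by positivity.\<close>
    have "4 * (y \<bullet> f x) = (x + y) \<bullet> f (x + y) - (x - y) \<bullet> f (x - y)"
      using sym[of x y] by (simp add: linear_add[OF lin] linear_diff[OF lin] inner_simps inner_commute)
    also have "\<dots> \<le> M * (norm (x + y))\<^sup>2"
      using nonneg[of "x - y"] bound[of "x + y"] by linarith
    also have "\<dots> \<le> M * (norm x + norm y)\<^sup>2"
      by (intro mult_left_mono power_mono norm_triangle_ineq M norm_ge_zero)
    also have "\<dots> = 4 * (M * norm x * norm x)"
      by (simp add: ny power2_eq_square)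
    finally have "y \<bullet> f x \<le> M * norm x * norm x" by simp
    moreover have "y \<bullet> f x = norm (f x) * norm x"
      using fx by (simp add: y_def dot_square_norm power2_eq_square)
    ultimately show ?thesis using x by simp
  qed
qed

text \<open>Passing to real parts lets \<open>complex^'n\<close> be treated as a real inner product
  space, where the polarization bound applies.\<close>

lemma Re_cnj_sum_eq_inner:
  fixes x y :: "complex^'n"
  shows "Re (\<Sum>i\<in>UNIV. cnj (x $ i) * y $ i) = x \<bullet> y"
  by (simp add: inner_vec_def inner_complex_def)

lemma hermitian_nth: "hermitian A \<Longrightarrow> cnj (A $ j $ i) = A $ i $ j"
  by (auto simp: hermitian_def adjoint_matrix_def map_matrix_def transpose_def vec_eq_iff)

lemma hermitian_inner_sym:
  assumes "hermitian A"
  shows "x \<bullet> (A *v y) = (A *v x) \<bullet> y"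
proof -
  have "(\<Sum>i\<in>UNIV. cnj (x $ i) * (A *v y) $ i)
      = (\<Sum>i\<in>UNIV. \<Sum>j\<in>UNIV. cnj (x $ i) * (A $ i $ j * y $ j))"
    by (simp add: matrix_vector_mult_def sum_distrib_left)
  also have "\<dots> = (\<Sum>j\<in>UNIV. \<Sum>i\<in>UNIV. cnj (x $ i) * (A $ i $ j * y $ j))"
    by (rule sum.swap)
  also have "\<dots> = (\<Sum>j\<in>UNIV. cnj ((A *v x) $ j) * y $ j)"
    by (simp add: matrix_vector_mult_def sum_distrib_left sum_distrib_right
        hermitian_nth[OF assms] mult_ac)
  finally show ?thesis by (metis Re_cnj_sum_eq_inner)
qed

lemma hermitian_psd_inner_nonneg:
  assumes "hermitian_psd A"
  shows "0 \<le> x \<bullet> (A *v x)"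
  using assms unfolding hermitian_psd_def complex_nonneg_Reals_iff Re_cnj_sum_eq_inner by blast

text \<open>Each diagonal entry is the value of the quadratic form at a standard basis
  vector.\<close>

lemma hermitian_psd_trace_nonneg:
  assumes "hermitian_psd A"
  shows "0 \<le> Re (trace A)"
proof -
  have "0 \<le> Re (A $ i $ i)" for i
  proof -
    have "(A *v axis i 1) $ i = A $ i $ i"
      by (simp add: matrix_vector_mult_def axis_def if_distrib cong: if_cong)
    then have "axis i 1 \<bullet> (A *v axis i 1) = Re (A $ i $ i)"
      by (simp add: inner_axis' inner_complex_def)
    then show ?thesis using hermitian_psd_inner_nonneg[OF assms, of "axis i 1"] by simp
  qed
  then show ?thesis by (simp add: trace_def sum_nonneg)
qed

lemma norm2_pos:
  assumes "A \<noteq> 0"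
  shows "0 < norm2 A"
proof -
  obtain x where "A *v x \<noteq> 0" using assms by (metis matrix_eq matrix_vector_mult_0)
  then show ?thesis
    unfolding norm2_def by (subst onorm_pos_lt) auto
qed

lemma norm2_le_norm2_add:
  assumes A: "hermitian_psd A" and B: "hermitian_psd B"
  shows "norm2 A \<le> norm2 (A + B)"
proof -
  have "x \<bullet> (A *v x) \<le> norm2 (A + B) * (norm x)\<^sup>2" for x
  proof -
    have "x \<bullet> (A *v x) \<le> x \<bullet> ((A + B) *v x)"
      using hermitian_psd_inner_nonneg[OF B, of x]
      by (simp add: matrix_vector_mult_add_rdistrib inner_simps)
    also have "\<dots> \<le> norm x * norm ((A + B) *v x)" by (rule norm_cauchy_schwarz)
    also have "\<dots> \<le> norm x * (norm2 (A + B) * norm x)"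
      unfolding norm2_def by (intro mult_left_mono onorm) auto
    finally show ?thesis by (simp add: power2_eq_square mult_ac)
  qed
  moreover have "hermitian A" using A by (simp add: hermitian_psd_def)
  \<comment> \<open>The polarization bound with \<open>M = norm2 (A + B)\<close> upgrades the
    estimate on the form of \<open>A\<close> to one on the vector \<open>A *v x\<close>.\<close>
  ultimately have "norm (A *v x) \<le> norm2 (A + B) * norm x" for x
    using A by (intro norm_le_of_quadratic_form_le hermitian_inner_sym hermitian_psd_inner_nonneg)
      (auto intro: bounded_linear.linear)
  then show ?thesis unfolding norm2_def[of A] by (rule onorm_le)
qed

theorem theorem3p3:
  fixes A B :: "complex^'n^'n"
  assumes "hermitian_psd A" and "hermitian_psd B"
  shows "intdim (A + B) \<le> intdim A + intdim B"
\<comment> \<open>With a zero summand, the convention \<open>intdim 0 = 0\<close> gives equality;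
  otherwise both norms are positive divisors.\<close>
proof (cases "A = 0 \<or> B = 0")
  case True
  then show ?thesis by (auto simp: intdim_def)
next
  case False
  then have pos: "0 < norm2 A" "0 < norm2 B" by (auto intro: norm2_pos)
  have le: "norm2 A \<le> norm2 (A + B)" "norm2 B \<le> norm2 (A + B)"
    using norm2_le_norm2_add[OF assms] norm2_le_norm2_add[OF assms(2,1)]
    by (simp_all add: add.commute)
  have tr: "0 \<le> Re (trace A)" "0 \<le> Re (trace B)"
    using assms by (auto intro: hermitian_psd_trace_nonneg)
  \<comment> \<open>No cancellation is possible: \<open>norm2 (A + B)\<close> is at least
    \<open>norm2 A > 0\<close>, so \<open>intdim (A + B)\<close> is a genuine quotient.\<close>
  have "norm2 (0 :: complex^'n^'n) = 0" by (simp add: norm2_def onorm_zero)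
  then have "A + B \<noteq> 0" using pos le by auto
  then have "intdim (A + B) = Re (trace A) / norm2 (A + B) + Re (trace B) / norm2 (A + B)"
    by (simp add: intdim_def trace_add add_divide_distrib)
  \<comment> \<open>Shrinking a denominator increases each fraction because the traces are
    non-negative.\<close>
  also have "\<dots> \<le> Re (trace A) / norm2 A + Re (trace B) / norm2 B"
    using pos le tr by (intro add_mono divide_left_mono) auto
  finally show ?thesis using False by (simp add: intdim_def)
qed

end
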